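(* Let $E=\mathrm{Dend}_2^1$ be the two-dimensional complex dendriform algebra with basis $\{e_1,e_2\}$ and products $e_1\prec e_1=e_1$, $e_1\succ e_2=e_2$, all other products of basis elements under $\prec$ and $\succ$ being zero. Then the only Rota-Baxter operator of weight $1$ on $E$ (in the sense defined in the context) is the zero operator $P=\begin{pmatrix}0&0\\0&0\end{pmatrix}$.
   Context: A dendriform algebra over $\mathbb{C}$ is a complex vector space $E$ with bilinear operations $\prec,\succ$ satisfying, for all $u,v,w\in E$: $(u\prec v)\prec w=u\prec(v\prec w)+u\prec(v\succ w)$; $(u\succ v)\prec w=u\succ(v\prec w)$; $u\succ(v\succ w)=(u\prec v)\succ w+(u\succ v)\succ w$. Matrix convention: the matrix $(a_{ij})$ of a linear map $P:E\to E$ is defined by rows, $P(e_1)=a_{11}e_1+a_{12}e_2$ and $P(e_2)=a_{21}e_1+a_{22}e_2$. For $\lambda\in\mathbb{C}$, a Rota-Baxter operator of weight $\lambda$ on $E$ is a linear map $P:E\to E$ such that for all $u,v\in E$: $$P(u)\prec P(v)=P\big(P(u)\prec v+u\prec P(v)+\lambda\,u\prec v\big),$$ $$P(u)\succ P(v)=P\big(P(u)\succ v+u\succ P(v)+\lambda\,u\prec v\big).$$ Note that in this definition the weight term is $\lambda\,u\prec v$ in both identities. Here $\lambda=1$. *)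

theory Defs
  imports "HOL-Analysis.Cartesian_Space"
begin

locale bilinear_products = vector_space smul
  for smul :: "complex \<Rightarrow> 'a::ab_group_add \<Rightarrow> 'a" +
  fixes prec :: "'a \<Rightarrow> 'a \<Rightarrow> 'a" (infixl \<open>\<prec>\<close> 70)
    and succ :: "'a \<Rightarrow> 'a \<Rightarrow> 'a" (infixl \<open>\<succ>\<close> 70)
  assumes prec_linear_right: "\<And>u. Vector_Spaces.linear smul smul (\<lambda>v. u \<prec> v)"
    and prec_linear_left: "\<And>v. Vector_Spaces.linear smul smul (\<lambda>u. u \<prec> v)"
    and succ_linear_right: "\<And>u. Vector_Spaces.linear smul smul (\<lambda>v. u \<succ> v)"
    and succ_linear_left: "\<And>v. Vector_Spaces.linear smul smul (\<lambda>u. u \<succ> v)"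

locale dendriform_algebra = bilinear_products smul prec succ
  for smul :: "complex \<Rightarrow> 'a::ab_group_add \<Rightarrow> 'a"
    and prec (infixl \<open>\<prec>\<close> 70) and succ (infixl \<open>\<succ>\<close> 70) +
  assumes prec_prec: "\<And>u v w. (u \<prec> v) \<prec> w = u \<prec> (v \<prec> w) + u \<prec> (v \<succ> w)"
    and succ_prec: "\<And>u v w. (u \<succ> v) \<prec> w = u \<succ> (v \<prec> w)"
    and succ_succ: "\<And>u v w. u \<succ> (v \<succ> w) = (u \<prec> v) \<succ> w + (u \<succ> v) \<succ> w"

text \<open>The weight term is \<open>\<lambda> u \<prec> v\<close> in both identities; this is intended.\<close>

definition rota_baxter_operator ::
  "(complex \<Rightarrow> 'a::ab_group_add \<Rightarrow> 'a) \<Rightarrow> ('a \<Rightarrow> 'a \<Rightarrow> 'a) \<Rightarrow> ('a \<Rightarrow> 'a \<Rightarrow> 'a)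
    \<Rightarrow> complex \<Rightarrow> ('a \<Rightarrow> 'a) \<Rightarrow> bool" where
  "rota_baxter_operator smul prec succ l P \<longleftrightarrow>
     Vector_Spaces.linear smul smul P \<and>
     (\<forall>u v. prec (P u) (P v) = P (prec (P u) v + prec u (P v) + smul l (prec u v))) \<and>
     (\<forall>u v. succ (P u) (P v) = P (succ (P u) v + succ u (P v) + smul l (prec u v)))"

text \<open>Row convention: row \<open>i\<close> of \<open>A\<close> holds the coordinates of the image of the
  \<open>i\<close>-th basis vector.\<close>

definition has_row_matrix ::
  "(complex \<Rightarrow> 'a::ab_group_add \<Rightarrow> 'a) \<Rightarrow> 'a \<Rightarrow> 'a \<Rightarrow> ('a \<Rightarrow> 'a) \<Rightarrow> complex^2^2 \<Rightarrow> bool" where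
  "has_row_matrix smul e1 e2 P A \<longleftrightarrow>
     P e1 = smul (A $ 1 $ 1) e1 + smul (A $ 1 $ 2) e2 \<and>
     P e2 = smul (A $ 2 $ 1) e1 + smul (A $ 2 $ 2) e2"

text \<open>The algebra \<open>Dend\<^sub>2\<^sup>1\<close>, on an arbitrary complex vector space with a two-element
  basis. The dendriform identities need not be assumed: they follow from the multiplication
  table, see the sublocale declaration below.\<close>

locale dend_2_1 = bilinear_products smul prec succ
  for smul :: "complex \<Rightarrow> 'a::ab_group_add \<Rightarrow> 'a"
    and prec (infixl \<open>\<prec>\<close> 70) and succ (infixl \<open>\<succ>\<close> 70) +
  fixes e1 e2 :: 'a
  assumes basis_distinct: "e1 \<noteq> e2"
    and basis_independent: "independent {e1, e2}"
    and basis_span: "span {e1, e2} = UNIV"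
    and prec_table: "e1 \<prec> e1 = e1" "e1 \<prec> e2 = 0" "e2 \<prec> e1 = 0" "e2 \<prec> e2 = 0"
    and succ_table: "e1 \<succ> e1 = 0" "e1 \<succ> e2 = e2" "e2 \<succ> e1 = 0" "e2 \<succ> e2 = 0"
begin

lemma coordinates: obtains a b where "u = smul a e1 + smul b e2"
proof -
  have "u \<in> span {e1, e2}" using basis_span by simp
  then obtain a where "u - smul a e1 \<in> span {e2}"
    by (auto simp: span_insert)
  then obtain b where "u - smul a e1 = smul b e2"
    by (auto simp: span_singleton)
  then show thesis by (intro that[of a b]) (simp add: algebra_simps)
qed

lemma prec_bilinear:
  "u \<prec> (v + w) = u \<prec> v + u \<prec> w" "(u + v) \<prec> w = u \<prec> w + v \<prec> w"
  "u \<prec> smul a v = smul a (u \<prec> v)" "smul a u \<prec> v = smul a (u \<prec> v)"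
  using prec_linear_right prec_linear_left by (auto simp: Vector_Spaces.linear_iff)

lemma prec_zero: "u \<prec> 0 = 0" "0 \<prec> u = 0"
  using prec_bilinear(3)[of u 0 0] prec_bilinear(4)[of 0 0 u] by simp_all

lemma succ_bilinear:
  "u \<succ> (v + w) = u \<succ> v + u \<succ> w" "(u + v) \<succ> w = u \<succ> w + v \<succ> w"
  "u \<succ> smul a v = smul a (u \<succ> v)" "smul a u \<succ> v = smul a (u \<succ> v)"
  using succ_linear_right succ_linear_left by (auto simp: Vector_Spaces.linear_iff)

lemma succ_zero: "u \<succ> 0 = 0" "0 \<succ> u = 0"
  using succ_bilinear(3)[of u 0 0] succ_bilinear(4)[of 0 0 u] by simp_all

lemmas table = prec_bilinear succ_bilinear prec_zero succ_zero prec_table succ_table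

sublocale dendriform_algebra smul prec succ
proof
  fix u v w
  obtain a b where u: "u = smul a e1 + smul b e2" by (rule coordinates)
  obtain c d where v: "v = smul c e1 + smul d e2" by (rule coordinates)
  obtain f g where w: "w = smul f e1 + smul g e2" by (rule coordinates)
  show "(u \<prec> v) \<prec> w = u \<prec> (v \<prec> w) + u \<prec> (v \<succ> w)"
    unfolding u v w by (simp add: table mult_ac)
  show "(u \<succ> v) \<prec> w = u \<succ> (v \<prec> w)"
    unfolding u v w by (simp add: table mult_ac)
  show "u \<succ> (v \<succ> w) = (u \<prec> v) \<succ> w + (u \<succ> v) \<succ> w"
    unfolding u v w by (simp add: table mult_ac)
qed

end

text \<open>The algebra exists, on \<open>\<complex>\<^sup>2\<close> with its standard basis.\<close>

lemma dend_2_1_exists: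
  "dend_2_1 (*s) (\<lambda>u v. (u $ 1 * v $ 1) *s axis 1 1) (\<lambda>u v. (u $ 1 * v $ 2) *s axis 2 1)
     (axis 1 1) (axis 2 1 :: complex^2)"
proof -
  have B: "{axis 1 1, axis 2 1 :: complex^2} = cart_basis"
    unfolding cart_basis_def by (auto simp: UNIV_2)
  show ?thesis
  proof unfold_locales
    show "vec.independent {axis 1 1, axis 2 1 :: complex^2}"
      unfolding B by (rule independent_cart_basis)
    show "vec.span {axis 1 1, axis 2 1 :: complex^2} = UNIV"
      unfolding B by (rule span_cart_basis)
  qed (auto simp: vec_eq_iff forall_2 axis_def algebra_simps)
qed

end

theory Submission
  imports Defs
begin

text \<open>Evaluating the two identities on basis vectors gives polynomial equations for the
  coordinates of \<open>P e1\<close> and \<open>P e2\<close>. The decisive fact is that the weight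
  term of the \<open>succ\<close> identity is a \<open>prec\<close> product: e1 \<prec> e1 = e1
  leaves a copy of \<open>P e1\<close> there, which forces \<open>P e1 = 0\<close>. Then
  \<open>P e2\<close> can only have zero coordinates, and linearity finishes; see
  \<open>rota_baxter_operator_weight_1_eq_0\<close>.\<close>

context dend_2_1
begin

lemma coordinates_eq_0:
  assumes "smul a e1 + smul b e2 = 0"
  shows "a = 0" "b = 0"
proof -
  have "(\<Sum>v\<in>{e1, e2}. smul (if v = e1 then a else b) v) = 0"
    using assms basis_distinct by auto
  then have "\<forall>v\<in>{e1, e2}. (if v = e1 then a else b) = 0"
    using independentD[OF basis_independent, of "{e1, e2}" "\<lambda>v. if v = e1 then a else b"]
    by blast
  then show "a = 0" "b = 0"
    using basis_distinct by auto
qed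

lemma rota_baxter_operator_weight_1_eq_0:
  assumes "rota_baxter_operator smul prec succ 1 P"
  shows "P = (\<lambda>_. 0)"
proof -
  have add: "P (u + v) = P u + P v" and scale: "P (smul x u) = smul x (P u)"
    and prec: "P u \<prec> P v = P (P u \<prec> v + u \<prec> P v + u \<prec> v)"
    and succ: "P u \<succ> P v = P (P u \<succ> v + u \<succ> P v + u \<prec> v)" for u v x
    using assms by (auto simp: rota_baxter_operator_def Vector_Spaces.linear_iff)
  have zero: "P 0 = 0"
    using scale[of 0 0] by simp
  obtain a b where P1: "P e1 = smul a e1 + smul b e2" by (rule coordinates)
  obtain c d where P2: "P e2 = smul c e1 + smul d e2" by (rule coordinates)
  \<comment> \<open>The identity reads a^2 e1 = (2a + 1) P e1. At both roots of a^2 + a the factor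
    2a + 1 is 1 or -1, so (2a + 1) b = 0 gives b = 0.\<close>
  have "smul (a * a + a) e1 + smul (b + a * b + a * b) e2 = 0"
    using prec[of e1 e1] unfolding scale_left_distrib
    by (simp add: P1 table add scale algebra_simps)
  then have "a * a + a = 0" and b: "b + a * b + a * b = 0"
    using coordinates_eq_0 by blast+
  then have "a = 0 \<or> a = - 1"
    by algebra
  with b have "b = 0"
    by auto
  \<comment> \<open>With b = 0 every \<succ> product here is a multiple of e1 \<succ> e1 = 0. Only
    the weight term survives, on the right, as P (e1 \<prec> e1) = P e1. This excludes a =
    -1.\<close>
  then have P1_0: "P e1 = 0"
    using succ[of e1 e1] by (simp add: P1 table)
  \<comment> \<open>The right side is P 0, since e2 annihilates everything under \<prec> from either
    side.\<close>
  have "smul (c * c) e1 + smul 0 e2 = 0"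
    using prec[of e2 e2] by (simp add: P2 table zero)
  then have c: "c = 0"
    using coordinates_eq_0(1) by fastforce
  \<comment> \<open>The left side vanishes because P e1 = 0; the right side is P (d e2) = d^2
    e2.\<close>
  have "smul 0 e1 + smul (d * d) e2 = 0"
    using succ[of e1 e2] by (simp add: P1_0 P2 c table scale)
  then have P2_0: "P e2 = 0"
    using coordinates_eq_0(2) by (fastforce simp: P2 c)
  show ?thesis
  proof
    fix u
    obtain x y where "u = smul x e1 + smul y e2" by (rule coordinates)
    then show "P u = 0"
      by (simp add: add scale P1_0 P2_0)
  qed
qed

lemma rota_baxter_operator_0: "rota_baxter_operator smul prec succ l (\<lambda>_. 0)"
  unfolding rota_baxter_operator_def Vector_Spaces.linear_iff
  using vector_space_axioms by (simp add: table)

end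

theorem theorem2p2:
  fixes smul :: "complex \<Rightarrow> 'a::ab_group_add \<Rightarrow> 'a"
    and prec succ :: "'a \<Rightarrow> 'a \<Rightarrow> 'a"
    and e1 e2 :: 'a
  assumes "dend_2_1 smul prec succ e1 e2"
  shows "{P. rota_baxter_operator smul prec succ 1 P} = {\<lambda>_. 0}
    \<and> has_row_matrix smul e1 e2 (\<lambda>_. 0) 0"
proof -
  interpret dend_2_1 smul prec succ e1 e2 by (rule assms)
  show ?thesis
    using rota_baxter_operator_weight_1_eq_0 rota_baxter_operator_0
    by (auto simp: has_row_matrix_def)
qed

end
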